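(* Let $d\in\mathbb N$ and let $A\in\mathcal B(\ell^2(\mathbb Z^d))$ have matrix entries satisfying $|A(k,l)|\le C e^{-\gamma|k-l|}$ for constants $C,\gamma>0$ and all $k,l\in\mathbb Z^d$. If $A$ is invertible in $\mathcal B(\ell^2(\mathbb Z^d))$, then there exist constants $C',\gamma'>0$ such that $$|A^{-1}(k,l)|\le C' e^{-\gamma'|k-l|}\qquad\text{for all }k,l\in\mathbb Z^d .$$
   Context: $\mathcal B(\ell^2(\mathbb Z^d))$ is the algebra of bounded operators on $\ell^2(\mathbb Z^d)$; operators are identified with their matrices $(A(k,l))_{k,l\in\mathbb Z^d}$ with respect to the standard basis. $|\cdot|$ on $\mathbb Z^d$ is a fixed norm on $\mathbb R^d$ (e.g. the Euclidean norm). *)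

theory Defs
  imports "HOL-Analysis.Analysis"
begin

section \<open>The Hilbert space of square-summable complex families\<close>

lemma sq_summable_sum:
  fixes f g :: "'a \<Rightarrow> complex"
  assumes f: "(\<lambda>i. (cmod (f i))\<^sup>2) summable_on UNIV"
    and g: "(\<lambda>i. (cmod (g i))\<^sup>2) summable_on UNIV"
  shows "(\<lambda>i. (cmod (f i + g i))\<^sup>2) summable_on UNIV"
    and "sqrt (\<Sum>\<^sub>\<infinity>i. (cmod (f i + g i))\<^sup>2)
          \<le> sqrt (\<Sum>\<^sub>\<infinity>i. (cmod (f i))\<^sup>2) + sqrt (\<Sum>\<^sub>\<infinity>i. (cmod (g i))\<^sup>2)"
proof -
  let ?b = "sqrt (\<Sum>\<^sub>\<infinity>i. (cmod (f i))\<^sup>2) + sqrt (\<Sum>\<^sub>\<infinity>i. (cmod (g i))\<^sup>2)"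
  have b0: "0 \<le> ?b"
    by (simp add: infsum_nonneg)
  have bound: "(\<Sum>i\<in>F. (cmod (f i + g i))\<^sup>2) \<le> ?b\<^sup>2" if "finite F" for F
  proof -
    have "L2_set (\<lambda>i. cmod (f i + g i)) F \<le> L2_set (\<lambda>i. cmod (f i) + cmod (g i)) F"
      by (rule L2_set_mono) (auto simp: norm_triangle_ineq)
    also have "\<dots> \<le> L2_set (\<lambda>i. cmod (f i)) F + L2_set (\<lambda>i. cmod (g i)) F"
      by (rule L2_set_triangle_ineq)
    also have "\<dots> \<le> ?b"
      unfolding L2_set_def
      by (intro add_mono real_sqrt_le_mono finite_sum_le_infsum f g that) auto
    finally have "(L2_set (\<lambda>i. cmod (f i + g i)) F)\<^sup>2 \<le> ?b\<^sup>2"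
      by (intro power_mono) auto
    then show ?thesis
      by (simp add: L2_set_def sum_nonneg)
  qed
  show sm: "(\<lambda>i. (cmod (f i + g i))\<^sup>2) summable_on UNIV"
    by (rule nonneg_bdd_above_summable_on) (auto intro!: bdd_aboveI bound)
  have "(\<Sum>\<^sub>\<infinity>i. (cmod (f i + g i))\<^sup>2) \<le> ?b\<^sup>2"
    by (rule infsum_le_finite_sums[OF sm]) (rule bound)
  then show "sqrt (\<Sum>\<^sub>\<infinity>i. (cmod (f i + g i))\<^sup>2) \<le> ?b"
    using b0 by (intro real_le_lsqrt)
qed

lemma sq_summable_cmult:
  fixes f :: "'a \<Rightarrow> complex"
  assumes "(\<lambda>i. (cmod (f i))\<^sup>2) summable_on UNIV"
  shows "(\<lambda>i. (cmod (c * f i))\<^sup>2) summable_on UNIV"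
  using summable_on_cmult_right[OF assms, of "(cmod c)\<^sup>2"]
  by (simp add: norm_mult power_mult_distrib)

typedef 'a ell2 = "{x :: 'a \<Rightarrow> complex. (\<lambda>i. (cmod (x i))\<^sup>2) summable_on UNIV}"
  morphisms ell2_apply Abs_ell2
  by (rule exI[of _ "\<lambda>_. 0"]) simp

setup_lifting type_definition_ell2

lift_definition scale_ell2 :: "complex \<Rightarrow> 'a ell2 \<Rightarrow> 'a ell2" is "\<lambda>c x i. c * x i"
  by (rule sq_summable_cmult)

lift_definition unit_ell2 :: "'a \<Rightarrow> 'a ell2" is "\<lambda>k i. if i = k then 1 else 0"
proof -
  fix k :: 'a
  have "(\<lambda>i. (cmod (if i = k then 1 else 0))\<^sup>2) summable_on {k}"
    by (rule summable_on_finite) simp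
  then show "(\<lambda>i. (cmod (if i = k then 1 else 0))\<^sup>2) summable_on UNIV"
    by (subst summable_on_cong_neutral[where T = "{k}"]) auto
qed

instantiation ell2 :: (type) real_normed_vector
begin

lift_definition zero_ell2 :: "'a ell2" is "\<lambda>_. 0"
  by simp

lift_definition plus_ell2 :: "'a ell2 \<Rightarrow> 'a ell2 \<Rightarrow> 'a ell2" is "\<lambda>x y i. x i + y i"
  by (rule sq_summable_sum)

lift_definition uminus_ell2 :: "'a ell2 \<Rightarrow> 'a ell2" is "\<lambda>x i. - x i"
  by simp

lift_definition minus_ell2 :: "'a ell2 \<Rightarrow> 'a ell2 \<Rightarrow> 'a ell2" is "\<lambda>x y i. x i - y i"
proof -
  fix x y :: "'a \<Rightarrow> complex"
  assume "(\<lambda>i. (cmod (x i))\<^sup>2) summable_on UNIV" "(\<lambda>i. (cmod (y i))\<^sup>2) summable_on UNIV"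
  then show "(\<lambda>i. (cmod (x i - y i))\<^sup>2) summable_on UNIV"
    using sq_summable_sum(1)[of x "\<lambda>i. - y i"] by simp
qed

lift_definition scaleR_ell2 :: "real \<Rightarrow> 'a ell2 \<Rightarrow> 'a ell2" is "\<lambda>r x i. complex_of_real r * x i"
  by (rule sq_summable_cmult)

lift_definition norm_ell2 :: "'a ell2 \<Rightarrow> real" is "\<lambda>x. sqrt (\<Sum>\<^sub>\<infinity>i. (cmod (x i))\<^sup>2)" .

definition dist_ell2 :: "'a ell2 \<Rightarrow> 'a ell2 \<Rightarrow> real" where
  "dist_ell2 x y = norm (x - y)"

definition sgn_ell2 :: "'a ell2 \<Rightarrow> 'a ell2" where
  "sgn_ell2 x = scaleR (inverse (norm x)) x"

definition uniformity_ell2 :: "('a ell2 \<times> 'a ell2) filter" where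
  "uniformity_ell2 = (INF e\<in>{0<..}. principal {(x, y). dist x y < e})"

definition open_ell2 :: "'a ell2 set \<Rightarrow> bool" where
  "open_ell2 U = (\<forall>x\<in>U. eventually (\<lambda>(x', y). x' = x \<longrightarrow> y \<in> U) uniformity)"

instance
proof
  fix x y z :: "'a ell2" and a b :: real and U :: "'a ell2 set"
  show "x + y + z = x + (y + z)" by transfer (simp add: algebra_simps)
  show "x + y = y + x" by transfer (simp add: algebra_simps)
  show "0 + x = x" by transfer simp
  show "- x + x = 0" by transfer simp
  show "x - y = x + - y" by transfer simp
  show "a *\<^sub>R (x + y) = a *\<^sub>R x + a *\<^sub>R y" by transfer (simp add: algebra_simps)
  show "(a + b) *\<^sub>R x = a *\<^sub>R x + b *\<^sub>R x" by transfer (simp add: algebra_simps)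
  show "a *\<^sub>R b *\<^sub>R x = (a * b) *\<^sub>R x" by transfer (simp add: algebra_simps)
  show "1 *\<^sub>R x = x" by transfer simp
  show "sgn x = scaleR (inverse (norm x)) x" by (rule sgn_ell2_def)
  show "dist x y = norm (x - y)" by (rule dist_ell2_def)
  show "uniformity = (INF e\<in>{0<..}. principal {(x, y :: 'a ell2). dist x y < e})"
    by (rule uniformity_ell2_def)
  show "open U = (\<forall>x\<in>U. eventually (\<lambda>(x', y). x' = x \<longrightarrow> y \<in> U) uniformity)"
    by (rule open_ell2_def)
  show "norm x = 0 \<longleftrightarrow> x = 0"
  proof transfer
    fix x :: "'a \<Rightarrow> complex"
    assume sm: "(\<lambda>i. (cmod (x i))\<^sup>2) summable_on UNIV"
    show "sqrt (\<Sum>\<^sub>\<infinity>i. (cmod (x i))\<^sup>2) = 0 \<longleftrightarrow> x = (\<lambda>_. 0)"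
    proof
      assume "sqrt (\<Sum>\<^sub>\<infinity>i. (cmod (x i))\<^sup>2) = 0"
      then have le: "(\<Sum>\<^sub>\<infinity>i. (cmod (x i))\<^sup>2) \<le> 0"
        by simp
      have "(cmod (x i))\<^sup>2 = 0" for i
        by (rule nonneg_infsum_le_0D[OF le sm]) simp_all
      then show "x = (\<lambda>_. 0)"
        by (simp add: fun_eq_iff)
    next
      assume "x = (\<lambda>_. 0)"
      then show "sqrt (\<Sum>\<^sub>\<infinity>i. (cmod (x i))\<^sup>2) = 0"
        by simp
    qed
  qed
  show "norm (x + y) \<le> norm x + norm y" by transfer (rule sq_summable_sum)
  show "norm (a *\<^sub>R x) = \<bar>a\<bar> * norm x"
  proof transfer
    fix a :: real and x :: "'a \<Rightarrow> complex"
    have "(\<Sum>\<^sub>\<infinity>i. (cmod (complex_of_real a * x i))\<^sup>2) = (\<Sum>\<^sub>\<infinity>i. a\<^sup>2 * (cmod (x i))\<^sup>2)"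
      by (simp add: norm_mult power_mult_distrib)
    also have "\<dots> = a\<^sup>2 * (\<Sum>\<^sub>\<infinity>i. (cmod (x i))\<^sup>2)"
      by (rule infsum_cmult_right')
    finally show "sqrt (\<Sum>\<^sub>\<infinity>i. (cmod (complex_of_real a * x i))\<^sup>2)
        = \<bar>a\<bar> * sqrt (\<Sum>\<^sub>\<infinity>i. (cmod (x i))\<^sup>2)"
      by (simp only: real_sqrt_mult real_sqrt_abs)
  qed
qed

end

section \<open>Bounded operators and their matrices\<close>

text \<open>
  The library type of bounded linear maps only knows about real scalars, so complex
  linearity is imposed separately.
\<close>

definition bounded_ops :: "('a ell2 \<Rightarrow>\<^sub>L 'a ell2) set" where
  "bounded_ops = {A. \<forall>c x. blinfun_apply A (scale_ell2 c x) = scale_ell2 c (blinfun_apply A x)}"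

text \<open>The entry in row \<open>k\<close> and column \<open>l\<close>, that is, the inner product of \<open>A e\<^sub>l\<close> with \<open>e\<^sub>k\<close>.\<close>

definition matrix_entry :: "('a ell2 \<Rightarrow>\<^sub>L 'a ell2) \<Rightarrow> 'a \<Rightarrow> 'a \<Rightarrow> complex" where
  "matrix_entry A k l = ell2_apply (blinfun_apply A (unit_ell2 l)) k"

definition is_inverse_op :: "('a ell2 \<Rightarrow>\<^sub>L 'a ell2) \<Rightarrow> ('a ell2 \<Rightarrow>\<^sub>L 'a ell2) \<Rightarrow> bool" where
  "is_inverse_op A B \<longleftrightarrow>
     B \<in> bounded_ops \<and> A o\<^sub>L B = id_blinfun \<and> B o\<^sub>L A = id_blinfun"

definition invertible_op :: "('a ell2 \<Rightarrow>\<^sub>L 'a ell2) \<Rightarrow> bool" where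
  "invertible_op A \<longleftrightarrow> (\<exists>B. is_inverse_op A B)"

definition inverse_op :: "('a ell2 \<Rightarrow>\<^sub>L 'a ell2) \<Rightarrow> ('a ell2 \<Rightarrow>\<^sub>L 'a ell2)" where
  "inverse_op A = (THE B. is_inverse_op A B)"

lemma is_inverse_op_unique:
  assumes "is_inverse_op A B" "is_inverse_op A B'"
  shows "B = B'"
proof (rule blinfun_eqI)
  fix x
  have "A o\<^sub>L B' = id_blinfun" and "B o\<^sub>L A = id_blinfun"
    using assms by (simp_all add: is_inverse_op_def)
  then have "blinfun_apply (A o\<^sub>L B') x = x" and "blinfun_apply (B o\<^sub>L A) (blinfun_apply B' x) = blinfun_apply B' x"
    by simp_all
  then show "blinfun_apply B x = blinfun_apply B' x" by simp
qed

lemma is_inverse_op_inverse_op: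
  assumes "invertible_op A"
  shows "is_inverse_op A (inverse_op A)"
proof -
  obtain B where B: "is_inverse_op A B"
    using assms by (auto simp: invertible_op_def)
  show ?thesis
    unfolding inverse_op_def
    by (rule theI[of _ B]) (use B in \<open>auto intro: is_inverse_op_unique\<close>)
qed

section \<open>Norms on \<open>\<real>\<^sup>d\<close> and the integer lattice\<close>

definition is_norm :: "('v::real_vector \<Rightarrow> real) \<Rightarrow> bool" where
  "is_norm N \<longleftrightarrow>
     (\<forall>x. 0 \<le> N x) \<and>
     (\<forall>x. N x = 0 \<longleftrightarrow> x = 0) \<and>
     (\<forall>a x. N (a *\<^sub>R x) = \<bar>a\<bar> * N x) \<and>
     (\<forall>x y. N (x + y) \<le> N x + N y)"

definition lattice_vec :: "int ^ 'd \<Rightarrow> real ^ 'd" where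
  "lattice_vec k = (\<chi> i. real_of_int (k $ i))"

end

(* Combes--Thomas argument. For x = A^{-1} e_l put y = w x with a bounded exponential weight w
   centred at l. Then A y = e_l + z, where z involves only the commutator of A with w. Its kernel is
   dominated by a convolution kernel whose l^1 norm is O(eps), eps being the exponent of the weight,
   so Young's inequality and the boundedness of A^{-1} give norm y <= 2 norm A^{-1}. *)
theory Submission
  imports Defs
begin

section \<open>Coordinates, expansion in unit vectors and matrix action on square-summable
  families\<close>

section \<open>Square-summable families\<close>

lemma L2_set_le_norm_ell2:
  assumes "finite F"
  shows "L2_set (\<lambda>i. cmod (ell2_apply x i)) F \<le> norm x"
  using assms unfolding L2_set_def
  by transfer (intro real_sqrt_le_mono finite_sum_le_infsum, auto)

text \<open>The norm is the supremum of its finite sections. Norm bounds thus reduce to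
  \<open>L2_set\<close>, where Minkowski's inequality is at hand.\<close>

lemma norm_ell2_leI:
  assumes "0 \<le> c" "\<And>F. finite F \<Longrightarrow> L2_set (\<lambda>i. cmod (ell2_apply x i)) F \<le> c"
  shows "norm x \<le> c"
  using assms
proof transfer
  fix c and x :: "'a \<Rightarrow> complex"
  assume sm: "(\<lambda>i. (cmod (x i))\<^sup>2) summable_on UNIV" and c: "0 \<le> c"
    and *: "\<And>F. finite F \<Longrightarrow> L2_set (\<lambda>i. cmod (x i)) F \<le> c"
  have "(\<Sum>\<^sub>\<infinity>i. (cmod (x i))\<^sup>2) \<le> c\<^sup>2"
  proof (rule infsum_le_finite_sums[OF sm])
    fix F :: "'a set" assume "finite F"
    then have "(L2_set (\<lambda>i. cmod (x i)) F)\<^sup>2 \<le> c\<^sup>2"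
      by (intro power_mono *) auto
    then show "(\<Sum>i\<in>F. (cmod (x i))\<^sup>2) \<le> c\<^sup>2"
      by (simp add: L2_set_def sum_nonneg)
  qed
  with c show "sqrt (\<Sum>\<^sub>\<infinity>i. (cmod (x i))\<^sup>2) \<le> c"
    by (intro real_le_lsqrt)
qed

lemma cmod_ell2_apply_le: "cmod (ell2_apply x i) \<le> norm x"
  using L2_set_le_norm_ell2[of "{i}" x] by simp

lemma bounded_linear_ell2_apply: "bounded_linear (\<lambda>x. ell2_apply x i)"
proof (rule bounded_linear_intro)
  show "ell2_apply (x + y) i = ell2_apply x i + ell2_apply y i" for x y
    by (simp add: plus_ell2.rep_eq)
  show "ell2_apply (r *\<^sub>R x) i = r *\<^sub>R ell2_apply x i" for r x
    by (simp add: scaleR_ell2.rep_eq scaleR_conv_of_real)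
  show "cmod (ell2_apply x i) \<le> norm x * 1" for x
    by (simp add: cmod_ell2_apply_le)
qed

lemma ell2_apply_unit: "ell2_apply (unit_ell2 l) k = (if k = l then 1 else 0)"
  by (simp add: unit_ell2.rep_eq)

lemma norm_unit_ell2: "norm (unit_ell2 l) = 1"
proof transfer
  fix l :: 'a
  have "(\<Sum>\<^sub>\<infinity>i. (cmod (if i = l then 1 else 0))\<^sup>2) = (\<Sum>\<^sub>\<infinity>i\<in>{l}. (cmod (if i = l then 1 else 0))\<^sup>2)"
    by (rule infsum_cong_neutral) auto
  then show "sqrt (\<Sum>\<^sub>\<infinity>i. (cmod (if i = l then 1 else 0))\<^sup>2) = 1"
    by simp
qed

text \<open>Supplies the weighted vector y = w x of the Combes--Thomas argument. Boundedness of the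
  weight is what keeps the product square-summable.\<close>

lemma ell2_bounded_multiple:
  fixes w :: "'a \<Rightarrow> complex"
  assumes "\<And>i. cmod (w i) \<le> K"
  obtains y where "\<And>i. ell2_apply y i = w i * ell2_apply x i"
proof -
  have "(\<lambda>i. K\<^sup>2 * (cmod (ell2_apply x i))\<^sup>2) summable_on UNIV"
    using ell2_apply[of x] by (intro summable_on_cmult_right) auto
  then have "(\<lambda>i. (cmod (w i * ell2_apply x i))\<^sup>2) summable_on UNIV"
    by (rule summable_on_comparison_test)
      (auto simp: norm_mult power_mult_distrib intro!: mult_right_mono power_mono assms)
  then have "ell2_apply (Abs_ell2 (\<lambda>i. w i * ell2_apply x i)) = (\<lambda>i. w i * ell2_apply x i)"
    by (intro Abs_ell2_inverse) simp
  then show thesis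
    by (intro that) (rule fun_cong)
qed

text \<open>The squared distance from \<open>x\<close> to a finite partial sum over \<open>F\<close>
  is the total of the squared moduli minus their sum over \<open>F\<close>, which tends to
  0.\<close>

lemma has_sum_unit_ell2:
  "((\<lambda>j. scale_ell2 (ell2_apply x j) (unit_ell2 j)) has_sum x) UNIV"
  unfolding has_sum_def
proof (rule Lim_null[THEN iffD2], rule tendsto_norm_zero_cancel)
  let ?s = "sum (\<lambda>j. scale_ell2 (ell2_apply x j) (unit_ell2 j))"
  let ?g = "\<lambda>i. (cmod (ell2_apply x i))\<^sup>2"
  have sm: "?g summable_on UNIV"
    using ell2_apply[of x] by auto
  have app: "ell2_apply (?s F) i = (if i \<in> F then ell2_apply x i else 0)" if "finite F" for F i
    using that
    by (induction F) (auto simp: zero_ell2.rep_eq plus_ell2.rep_eq scale_ell2.rep_eq unit_ell2.rep_eq)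
  have norm: "norm (?s F - x) = sqrt ((\<Sum>\<^sub>\<infinity>i. ?g i) - sum ?g F)" if "finite F" for F
  proof -
    have "(\<Sum>\<^sub>\<infinity>i. (cmod (ell2_apply (?s F - x) i))\<^sup>2) = (\<Sum>\<^sub>\<infinity>i\<in>UNIV - F. ?g i)"
      using that by (intro infsum_cong_neutral) (auto simp: minus_ell2.rep_eq app)
    also have "\<dots> = (\<Sum>\<^sub>\<infinity>i. ?g i) - sum ?g F"
      using that sm by (subst infsum_Diff) auto
    finally show ?thesis
      by (simp add: norm_ell2.rep_eq)
  qed
  have "((\<lambda>F. sqrt ((\<Sum>\<^sub>\<infinity>i. ?g i) - sum ?g F)) \<longlongrightarrow> sqrt ((\<Sum>\<^sub>\<infinity>i. ?g i) - (\<Sum>\<^sub>\<infinity>i. ?g i)))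
      (finite_subsets_at_top UNIV)"
    by (intro tendsto_intros infsum_tendsto sm)
  then have lim: "((\<lambda>F. sqrt ((\<Sum>\<^sub>\<infinity>i. ?g i) - sum ?g F)) \<longlongrightarrow> 0) (finite_subsets_at_top UNIV)"
    by simp
  show "((\<lambda>F. norm (?s F - x)) \<longlongrightarrow> 0) (finite_subsets_at_top UNIV)"
    by (rule Lim_transform_eventually[OF lim])
      (auto intro!: eventually_finite_subsets_at_top_weakI simp: norm)
qed

text \<open>The coordinate functional composed with \<open>A\<close> is continuous, so it may be
  applied termwise to the expansion of \<open>x\<close> in unit vectors. Complex linearity of
  \<open>A\<close> pulls out the coefficients.\<close>

lemma has_sum_matrix_entry:
  assumes "A \<in> bounded_ops"
  shows "((\<lambda>j. matrix_entry A k j * ell2_apply x j) has_sum ell2_apply (blinfun_apply A x) k) UNIV"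
proof -
  have "bounded_linear (\<lambda>x. ell2_apply (blinfun_apply A x) k)"
    by (rule bounded_linear_compose[OF bounded_linear_ell2_apply blinfun.bounded_linear_right])
  from has_sum_bounded_linear[OF this has_sum_unit_ell2[of x]] show ?thesis
    using assms by (simp add: bounded_ops_def scale_ell2.rep_eq matrix_entry_def mult.commute)
qed

section \<open>Young's inequality for convolution of a summable kernel with a square-summable
  family\<close>

lemma L2_set_sum_le:
  assumes "finite G"
  shows "L2_set (\<lambda>i. \<Sum>m\<in>G. f m i) F \<le> (\<Sum>m\<in>G. L2_set (f m) F)"
  using assms
proof (induction G)
  case (insert m G)
  then show ?case
    using L2_set_triangle_ineq[of "f m" "\<lambda>i. \<Sum>m\<in>G. f m i" F] by simp
qed (simp add: L2_set_0')

lemma summable_on_convolution: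
  fixes h :: "'a::ab_group_add \<Rightarrow> real"
  assumes h: "\<And>m. 0 \<le> h m" "h summable_on UNIV"
  shows "(\<lambda>m. h m * cmod (ell2_apply y (k - m))) summable_on UNIV"
    and "(\<lambda>j. h (k - j) * cmod (ell2_apply y j)) summable_on UNIV"
proof -
  show *: "(\<lambda>m. h m * cmod (ell2_apply y (k - m))) summable_on UNIV"
    by (rule summable_on_comparison_test[OF summable_on_cmult_left[OF h(2), of "norm y"]])
      (auto intro!: mult_left_mono mult_nonneg_nonneg h cmod_ell2_apply_le)
  have "bij_betw (\<lambda>j. k - j) UNIV UNIV"
    by (rule bij_betwI[of _ _ _ "\<lambda>j. k - j"]) auto
  from summable_on_reindex_bij_betw[OF this, of "\<lambda>m. h m * cmod (ell2_apply y (k - m))"] *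
  show "(\<lambda>j. h (k - j) * cmod (ell2_apply y j)) summable_on UNIV"
    by simp
qed

text \<open>After substituting m = k - j, the convolution is a superposition of translates of y with
  weights \<open>h m\<close>. Each translate has the norm of y, so Minkowski's inequality gives the
  factor \<open>infsum h UNIV\<close>.\<close>

lemma norm_ell2_le_convolution:
  fixes h :: "'a::ab_group_add \<Rightarrow> real"
  assumes h: "\<And>m. 0 \<le> h m" "h summable_on UNIV"
    and z: "\<And>k. cmod (ell2_apply z k) \<le> (\<Sum>\<^sub>\<infinity>j. h (k - j) * cmod (ell2_apply y j))"
  shows "norm z \<le> infsum h UNIV * norm y"
proof (rule norm_ell2_leI)
  show "0 \<le> infsum h UNIV * norm y"
    by (simp add: infsum_nonneg h)
  fix F :: "'a set" assume F: "finite F"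
  let ?c = "\<lambda>k m. h m * cmod (ell2_apply y (k - m))"
  have bij: "bij_betw (\<lambda>j. k - j) UNIV UNIV" for k :: 'a
    by (rule bij_betwI[of _ _ _ "\<lambda>j. k - j"]) auto
  have z': "cmod (ell2_apply z k) \<le> (\<Sum>\<^sub>\<infinity>m. ?c k m)" for k
    using z[of k] infsum_reindex_bij_betw[OF bij[of k], of "?c k"] by simp
  have fin: "L2_set (\<lambda>k. \<Sum>m\<in>G. ?c k m) F \<le> infsum h UNIV * norm y" if "finite G" for G
  proof -
    have "L2_set (\<lambda>k. \<Sum>m\<in>G. ?c k m) F \<le> (\<Sum>m\<in>G. L2_set (\<lambda>k. ?c k m) F)"
      by (rule L2_set_sum_le[OF that])
    also have "\<dots> \<le> (\<Sum>m\<in>G. h m * norm y)"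
    proof (rule sum_mono)
      fix m
      have "L2_set (\<lambda>k. cmod (ell2_apply y (k - m))) F
          = L2_set (\<lambda>k. cmod (ell2_apply y k)) ((\<lambda>k. k - m) ` F)"
        unfolding L2_set_def by (subst sum.reindex) (auto simp: inj_on_def)
      also have "\<dots> \<le> norm y"
        using F by (intro L2_set_le_norm_ell2) auto
      finally show "L2_set (\<lambda>k. ?c k m) F \<le> h m * norm y"
        using h(1)[of m] by (simp add: L2_set_right_distrib[symmetric] mult_left_mono)
    qed
    also have "\<dots> \<le> infsum h UNIV * norm y"
      unfolding sum_distrib_right[symmetric]
      by (intro mult_right_mono finite_sum_le_infsum h that) (auto simp: h)
    finally show ?thesis .
  qed
  \<comment> \<open>With \<open>F\<close> fixed and finite, \<open>L2_set\<close> over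
    \<open>F\<close> depends continuously on finitely many values, so the bound for finite
    \<open>G\<close> survives the limit.\<close>
  have "((\<lambda>G. L2_set (\<lambda>k. \<Sum>m\<in>G. ?c k m) F) \<longlongrightarrow> L2_set (\<lambda>k. \<Sum>\<^sub>\<infinity>m. ?c k m) F)
      (finite_subsets_at_top UNIV)"
    unfolding L2_set_def
    by (intro tendsto_intros infsum_tendsto summable_on_convolution h)
  then have "L2_set (\<lambda>k. \<Sum>\<^sub>\<infinity>m. ?c k m) F \<le> infsum h UNIV * norm y"
    by (rule tendsto_upperbound)
      (auto intro!: eventually_finite_subsets_at_top_weakI fin)
  moreover have "L2_set (\<lambda>k. cmod (ell2_apply z k)) F \<le> L2_set (\<lambda>k. \<Sum>\<^sub>\<infinity>m. ?c k m) F"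
    by (intro L2_set_mono z') auto
  ultimately show "L2_set (\<lambda>k. cmod (ell2_apply z k)) F \<le> infsum h UNIV * norm y"
    by linarith
qed

section \<open>The Combes--Thomas estimate on an abelian group\<close>

section \<open>The weighted estimate\<close>

text \<open>Factor out \<open>exp a\<close>. What remains is |1 - exp s| with |s| \<le> u; the case
  s < 0 is also bounded by exp u - 1 because cosh u \<ge> 1.\<close>

lemma abs_exp_diff_le:
  fixes a b u :: real
  assumes "\<bar>a - b\<bar> \<le> u"
  shows "\<bar>exp a - exp b\<bar> \<le> (exp u - 1) * exp a"
proof -
  have "exp (b - a) \<le> exp u" "exp (- u) \<le> exp (b - a)"
    using assms by auto
  moreover have "2 \<le> exp u + exp (- u)"
    using cosh_real_ge_1[of u] by (simp add: cosh_def)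
  ultimately have "\<bar>1 - exp (b - a)\<bar> \<le> exp u - 1"
    by linarith
  then have "\<bar>1 - exp (b - a)\<bar> * exp a \<le> (exp u - 1) * exp a"
    by (intro mult_right_mono) auto
  also have "\<bar>1 - exp (b - a)\<bar> * exp a = \<bar>(1 - exp (b - a)) * exp a\<bar>"
    by (simp add: abs_mult)
  also have "(1 - exp (b - a)) * exp a = exp a - exp b"
    by (simp add: left_diff_distrib exp_add[symmetric])
  finally show ?thesis .
qed

text \<open>The decay rate \<gamma> is split: one half pays for the growth exp (\<epsilon> t), one
  quarter absorbs the linear factor t from exp (\<epsilon> t) - 1 \<le> \<epsilon> t exp (\<epsilon>
  t), and one quarter remains. The prefactor is linear in \<epsilon>, which makes the commutator
  small.\<close>

lemma exp_kernel_le: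
  fixes \<epsilon> \<gamma> t :: real
  assumes "0 < \<gamma>" "0 \<le> \<epsilon>" "\<epsilon> \<le> \<gamma> / 2" "0 \<le> t"
  shows "exp (- \<gamma> * t) * (exp (\<epsilon> * t) - 1) \<le> \<epsilon> * (4 / \<gamma>) * exp (- (\<gamma> / 4) * t)"
proof -
  have "1 - exp (- (\<epsilon> * t)) \<le> \<epsilon> * t"
    using exp_ge_add_one_self[of "- (\<epsilon> * t)"] by linarith
  then have "exp (\<epsilon> * t) * (1 - exp (- (\<epsilon> * t))) \<le> exp (\<epsilon> * t) * (\<epsilon> * t)"
    by (rule mult_left_mono) auto
  then have 1: "exp (\<epsilon> * t) - 1 \<le> exp (\<epsilon> * t) * (\<epsilon> * t)"
    by (simp add: right_diff_distrib exp_add[symmetric])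
  have "\<gamma> / 4 * t \<le> exp (\<gamma> / 4 * t)"
    using exp_ge_add_one_self[of "\<gamma> / 4 * t"] by linarith
  then have 2: "t \<le> 4 / \<gamma> * exp (\<gamma> / 4 * t)"
    using assms by (simp add: field_simps)
  have "exp (\<epsilon> * t) * (\<epsilon> * t) \<le> exp (\<gamma> / 2 * t) * (\<epsilon> * (4 / \<gamma> * exp (\<gamma> / 4 * t)))"
    using assms 2 by (intro mult_mono) (auto intro!: mult_right_mono mult_left_mono simp del: times_divide_eq_left)
  then have "exp (- \<gamma> * t) * (exp (\<epsilon> * t) - 1)
      \<le> exp (- \<gamma> * t) * (exp (\<gamma> / 2 * t) * (\<epsilon> * (4 / \<gamma> * exp (\<gamma> / 4 * t))))"
    using 1 by (intro mult_left_mono) auto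
  also have "\<dots> = \<epsilon> * (4 / \<gamma>) * exp (- \<gamma> * t + \<gamma> / 2 * t + \<gamma> / 4 * t)"
    unfolding exp_add by (simp only: mult_ac)
  also have "- \<gamma> * t + \<gamma> / 2 * t + \<gamma> / 4 * t = - (\<gamma> / 4) * t"
    by (simp add: field_simps)
  finally show ?thesis .
qed

text \<open>The geometry enters only through a symmetric subadditive \<open>p\<close> whose
  exponentials are summable. Symmetry and subadditivity make the weight log-Lipschitz; summability
  makes the commutator kernel an l^1 function.\<close>

theorem exponential_decay_inverse:
  fixes A B :: "'a::ab_group_add ell2 \<Rightarrow>\<^sub>L 'a ell2" and p :: "'a \<Rightarrow> real"
  assumes p_nonneg: "\<And>x. 0 \<le> p x" and p_0: "p 0 = 0" and p_minus: "\<And>x. p (- x) = p x"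
    and p_add: "\<And>x y. p (x + y) \<le> p x + p y"
    and p_summable: "\<And>a. 0 < a \<Longrightarrow> (\<lambda>x. exp (- a * p x)) summable_on UNIV"
    and A: "A \<in> bounded_ops" and pos: "C > 0" "\<gamma> > 0"
    and decay: "\<And>k l. cmod (matrix_entry A k l) \<le> C * exp (- \<gamma> * p (k - l))"
    and inv: "A o\<^sub>L B = id_blinfun" "B o\<^sub>L A = id_blinfun"
  shows "\<exists>C' > 0. \<exists>\<gamma>' > 0. \<forall>k l. cmod (matrix_entry B k l) \<le> C' * exp (- \<gamma>' * p (k - l))"
proof -
  define S where "S = (\<Sum>\<^sub>\<infinity>x. exp (- (\<gamma> / 4) * p x))"
  \<comment> \<open>\<open>D\<close> is chosen so that \<open>norm B\<close> times the l^1 norm of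
    the kernel \<open>h\<close> below is at most \<epsilon> \<open>D\<close>. The added ones keep
    \<open>D\<close> positive. The two bounds in the minimum defining \<epsilon> serve
    \<open>exp_kernel_le\<close> and the contraction factor 1/2.\<close>
  define D where "D = C * (4 / \<gamma>) * (S + 1) * (norm B + 1)"
  define \<epsilon> where "\<epsilon> = min (\<gamma> / 2) (1 / (2 * D))"
  have S: "0 \<le> S"
    unfolding S_def by (simp add: infsum_nonneg)
  have D: "0 < D"
    unfolding D_def using S pos by (intro mult_pos_pos) (auto simp: add_nonneg_pos)
  have \<epsilon>: "0 < \<epsilon>" "\<epsilon> \<le> \<gamma> / 2" "\<epsilon> * D \<le> 1 / 2"
  proof -
    show "0 < \<epsilon>" "\<epsilon> \<le> \<gamma> / 2"
      using D pos by (auto simp: \<epsilon>_def)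
    have "\<epsilon> * D \<le> 1 / (2 * D) * D"
      using D by (intro mult_right_mono) (auto simp: \<epsilon>_def)
    then show "\<epsilon> * D \<le> 1 / 2"
      using D by simp
  qed
  define h where "h = (\<lambda>m. C * (\<epsilon> * (4 / \<gamma>)) * exp (- (\<gamma> / 4) * p m))"
  have h_nonneg: "0 \<le> h m" for m
    using pos \<epsilon> by (simp add: h_def)
  have h_summable: "h summable_on UNIV"
    unfolding h_def using pos by (intro summable_on_cmult_right p_summable) auto
  have h_sum: "norm B * infsum h UNIV \<le> 1 / 2"
  proof -
    have "norm B * infsum h UNIV = \<epsilon> * (C * (4 / \<gamma>) * S * norm B)"
      unfolding h_def S_def by (subst infsum_cmult_right') (simp add: mult_ac)
    also have "\<dots> \<le> \<epsilon> * D"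
      unfolding D_def using pos \<epsilon> S by (intro mult_left_mono mult_mono) auto
    finally show ?thesis
      using \<epsilon>(3) by simp
  qed
  have p_diff: "p (x - z) \<le> p (x - y) + p (y - z)" for x y z
    using p_add[of "x - y" "y - z"] by simp
  have bound: "cmod (matrix_entry B k l) \<le> (2 * norm B + 1) * exp (- \<epsilon> * p (k - l))" for k l
  proof -
    (* Truncation at p (k - l) makes the weight bounded without changing its value at k. *)
    define q where "q = (\<lambda>j. \<epsilon> * min (p (j - l)) (p (k - l)))"
    define x where "x = blinfun_apply B (unit_ell2 l)"
    have "norm (complex_of_real (exp (q j))) \<le> exp (\<epsilon> * p (k - l))" for j
      using \<epsilon> by (auto simp: q_def)
    from ell2_bounded_multiple[of "\<lambda>j. complex_of_real (exp (q j))", OF this, of x]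
    obtain y where y: "\<And>j. ell2_apply y j = complex_of_real (exp (q j)) * ell2_apply x j"
      by blast
    have Ax: "blinfun_apply A x = unit_ell2 l"
      using arg_cong[OF inv(1), of "\<lambda>T. blinfun_apply T (unit_ell2 l)"] by (simp add: x_def)
    have BA: "blinfun_apply B (blinfun_apply A y) = y"
      using arg_cong[OF inv(2), of "\<lambda>T. blinfun_apply T y"] by simp
    define z where "z = blinfun_apply A y - unit_ell2 l"
    \<comment> \<open>Truncation by a minimum is 1-Lipschitz, so the log-weight inherits the
      Lipschitz bound that the triangle inequality gives for \<open>p\<close>.\<close>
    have q_diff: "\<bar>q j - q i\<bar> \<le> \<epsilon> * p (i - j)" for i j
    proof -
      have "\<bar>min (p (j - l)) (p (k - l)) - min (p (i - l)) (p (k - l))\<bar> \<le> p (i - j)"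
        using p_diff[of i l j] p_diff[of j l i] p_minus[of "i - j"] p_nonneg[of "i - j"] by auto
      then show ?thesis
        using \<epsilon>(1) by (simp add: q_def right_diff_distrib[symmetric] abs_mult)
    qed
    have "norm z \<le> infsum h UNIV * norm y"
    proof (rule norm_ell2_le_convolution[OF h_nonneg h_summable])
      fix i
      \<comment> \<open>The terms of the commutator of \<open>A\<close> with the weight, applied to
        \<open>x\<close>, at coordinate \<open>i\<close>.\<close>
      let ?f = "\<lambda>j. matrix_entry A i j * (complex_of_real (exp (q j)) - complex_of_real (exp (q i)))
        * ell2_apply x j"
      have "((\<lambda>j. matrix_entry A i j * ell2_apply y j
            + (- complex_of_real (exp (q i))) * (matrix_entry A i j * ell2_apply x j))
          has_sum ell2_apply (blinfun_apply A y) i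
            + (- complex_of_real (exp (q i))) * ell2_apply (blinfun_apply A x) i) UNIV"
        by (intro has_sum_add has_sum_cmult_right has_sum_matrix_entry A)
      \<comment> \<open>Since \<open>p 0 = 0\<close>, the weight is 1 at its centre
        \<open>l\<close>; at every other index \<open>unit_ell2 l\<close> vanishes. Hence weighting
        \<open>A x\<close> changes nothing.\<close>
      moreover have "complex_of_real (exp (q i)) * ell2_apply (blinfun_apply A x) i
          = ell2_apply (unit_ell2 l) i"
        by (auto simp: Ax ell2_apply_unit q_def p_0 p_nonneg)
      ultimately have hs: "(?f has_sum ell2_apply z i) UNIV"
        by (simp add: z_def minus_ell2.rep_eq y algebra_simps)
      \<comment> \<open>The weight difference is measured relative to exp (\<open>q j\<close>), so
        that this factor recombines with \<open>x\<close> at \<open>j\<close> into \<open>y\<close>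
        at \<open>j\<close>.\<close>
      have le: "cmod (?f j) \<le> h (i - j) * cmod (ell2_apply y j)" for j
      proof -
        have "cmod (complex_of_real (exp (q j)) - complex_of_real (exp (q i)))
            \<le> (exp (\<epsilon> * p (i - j)) - 1) * exp (q j)"
          using abs_exp_diff_le[OF q_diff[of j i]] by (simp add: norm_of_real flip: of_real_diff)
        then have "cmod (?f j) \<le> (C * exp (- \<gamma> * p (i - j)))
            * ((exp (\<epsilon> * p (i - j)) - 1) * exp (q j)) * cmod (ell2_apply x j)"
          unfolding norm_mult using pos by (intro mult_right_mono mult_mono decay) auto
        also have "\<dots> = C * (exp (- \<gamma> * p (i - j)) * (exp (\<epsilon> * p (i - j)) - 1))
            * cmod (ell2_apply y j)"
          by (simp add: y norm_mult)
        also have "\<dots> \<le> C * (\<epsilon> * (4 / \<gamma>) * exp (- (\<gamma> / 4) * p (i - j))) * cmod (ell2_apply y j)"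
          using pos \<epsilon> p_nonneg by (intro mult_right_mono mult_left_mono exp_kernel_le) auto
        finally show ?thesis
          by (simp add: h_def mult.assoc)
      qed
      have sm: "(\<lambda>j. h (i - j) * cmod (ell2_apply y j)) summable_on UNIV"
        by (intro summable_on_convolution h_nonneg h_summable)
      have abs: "(\<lambda>j. cmod (?f j)) summable_on UNIV"
        by (rule summable_on_comparison_test[OF sm le]) auto
      have "cmod (ell2_apply z i) = cmod (infsum ?f UNIV)"
        using infsumI[OF hs] by simp
      also have "\<dots> \<le> (\<Sum>\<^sub>\<infinity>j. cmod (?f j))"
        by (rule norm_infsum_bound[OF abs])
      also have "\<dots> \<le> (\<Sum>\<^sub>\<infinity>j. h (i - j) * cmod (ell2_apply y j))"
        by (rule infsum_mono[OF abs sm le])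
      finally show "cmod (ell2_apply z i) \<le> (\<Sum>\<^sub>\<infinity>j. h (i - j) * cmod (ell2_apply y j))" .
    qed
    moreover have "norm y \<le> norm B * (1 + norm z)"
    proof -
      have "norm y \<le> norm B * norm (blinfun_apply A y)"
        using norm_blinfun[of B "blinfun_apply A y"] by (simp add: BA)
      also have "norm (blinfun_apply A y) \<le> 1 + norm z"
        using norm_triangle_ineq[of "unit_ell2 l" z] by (simp add: z_def norm_unit_ell2)
      finally show ?thesis
        by (simp add: mult_left_mono)
    qed
    ultimately have "norm y \<le> norm B * (1 + infsum h UNIV * norm y)"
      by (smt (verit) mult_left_mono norm_ge_zero)
    also have "\<dots> = norm B + (norm B * infsum h UNIV) * norm y"
      by (simp add: algebra_simps)
    also have "\<dots> \<le> norm B + 1 / 2 * norm y"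
      by (intro add_left_mono mult_right_mono h_sum) auto
    \<comment> \<open>The term 1/2 \<open>norm y\<close> is absorbed on the left, which is
      legitimate because the truncated weight put \<open>y\<close> in the space. The extra 1 makes
      the final constant positive even when \<open>norm B\<close> is 0.\<close>
    finally have "norm y \<le> 2 * norm B + 1"
      by simp
    then have "exp (\<epsilon> * p (k - l)) * cmod (ell2_apply x k) \<le> 2 * norm B + 1"
      using cmod_ell2_apply_le[of y k] by (simp add: y norm_mult q_def)
    then show ?thesis
      by (simp add: matrix_entry_def x_def exp_minus field_simps)
  qed
  then show ?thesis
    using \<epsilon>(1) by (intro exI[of _ "2 * norm B + 1"] exI[of _ \<epsilon>] conjI allI) (auto simp: add_nonneg_pos)
qed

section \<open>Comparison of an arbitrary norm with the Euclidean one\<close>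

section \<open>Norms on the lattice\<close>

text \<open>One half of the equivalence of norms in finite dimension: \<open>N\<close> is Lipschitz,
  hence continuous, so it attains a positive minimum on the compact unit sphere, and homogeneity
  extends the bound.\<close>

lemma is_norm_lower_bound:
  fixes N :: "real ^ 'd \<Rightarrow> real"
  assumes "is_norm N"
  obtains c where "c > 0" "\<And>x. c * norm x \<le> N x"
proof -
  have N: "\<And>x. 0 \<le> N x" "\<And>x. N x = 0 \<longleftrightarrow> x = 0" "\<And>a x. N (a *\<^sub>R x) = \<bar>a\<bar> * N x"
    "\<And>x y. N (x + y) \<le> N x + N y"
    using assms by (auto simp: is_norm_def)
  have N_sum: "N (sum f F) \<le> (\<Sum>i\<in>F. N (f i))" if "finite F" for f :: "'d \<Rightarrow> real ^ 'd" and F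
    using that
  proof (induction F)
    case (insert i F)
    then show ?case
      using N(4)[of "f i" "sum f F"] by simp
  qed (use N(2)[of 0] in simp)
  define K where "K = (\<Sum>i\<in>UNIV. N (axis i 1))"
  have upper: "N x \<le> K * norm x" for x
  proof -
    have "N x = N (\<Sum>i\<in>UNIV. (x $ i) *\<^sub>R axis i 1)"
      using basis_expansion[of x] by (simp add: scalar_mult_eq_scaleR)
    also have "\<dots> \<le> (\<Sum>i\<in>UNIV. \<bar>x $ i\<bar> * N (axis i 1))"
      using N_sum[of UNIV "\<lambda>i. (x $ i) *\<^sub>R axis i 1"] by (simp add: N(3))
    also have "\<dots> \<le> (\<Sum>i\<in>UNIV. norm x * N (axis i 1))"
      by (intro sum_mono mult_right_mono component_le_norm_cart N)
    finally show ?thesis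
      by (simp add: K_def sum_distrib_left mult.commute)
  qed
  have lip: "dist (N x) (N y) \<le> K * dist x y" for x y
    using N(4)[of "x - y" y] N(4)[of "y - x" x] upper[of "x - y"] upper[of "y - x"]
    by (simp add: dist_norm norm_minus_commute)
  have "K \<ge> 0"
    by (simp add: K_def sum_nonneg N)
  then have "continuous_on (sphere 0 1) N"
    by (intro lipschitz_on_continuous_on[of K]) (auto simp: lipschitz_on_def lip)
  \<comment> \<open>Any index serves here; the point only shows that the sphere is nonempty.\<close>
  moreover have "axis undefined 1 \<in> (sphere 0 1 :: (real ^ 'd) set)"
    by (simp add: norm_axis_1)
  ultimately obtain u where u: "u \<in> sphere 0 1" "\<And>x. x \<in> sphere 0 1 \<Longrightarrow> N u \<le> N x"
    using continuous_attains_inf[of "sphere 0 1" N] by (auto simp del: mem_sphere_0)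
  show thesis
  proof (rule that)
    show "N u > 0"
      using u(1) N(1)[of u] N(2)[of u] by fastforce
    show "N u * norm x \<le> N x" for x
    proof (cases "x = 0")
      case False
      then have "N u \<le> N ((1 / norm x) *\<^sub>R x)"
        by (intro u) simp
      also have "\<dots> = N x / norm x"
        by (simp add: N(3))
      finally show ?thesis
        using False by (simp add: field_simps)
    qed (simp add: N(1))
  qed
qed

section \<open>Summability of exponentials over the lattice\<close>

lemma summable_on_exp_abs_int:
  fixes b :: real
  assumes "b > 0"
  shows "(\<lambda>n::int. exp (- b * \<bar>real_of_int n\<bar>)) summable_on UNIV"
proof -
  have "(\<lambda>n::nat. exp (- b) ^ n) summable_on UNIV"
    using assms by (intro norm_summable_imp_summable_on) (simp add: summable_geometric)
  then have nat: "(\<lambda>n::nat. exp (- b * real n)) summable_on UNIV"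
    by (simp add: exp_of_nat_mult[symmetric] mult.commute)
  have "(\<lambda>n::int. exp (- b * \<bar>real_of_int n\<bar>)) summable_on range int"
    by (subst summable_on_reindex) (use nat in \<open>auto simp: o_def\<close>)
  moreover have "(\<lambda>n::int. exp (- b * \<bar>real_of_int n\<bar>)) summable_on range (\<lambda>n. - int n)"
    by (subst summable_on_reindex) (use nat in \<open>auto simp: o_def inj_on_def\<close>)
  moreover have "range int \<union> range (\<lambda>n. - int n) = UNIV"
  proof (rule UNIV_eq_I[symmetric])
    show "n \<in> range int \<union> range (\<lambda>n. - int n)" for n
      by (cases n rule: int_cases2) auto
  qed
  ultimately show ?thesis
    using summable_on_union by metis
qed

text \<open>A finite set of vectors lies in a box with side \<open>T\<close>, the finite set of all
  their coordinates. Over the box the sum of products factors into a product of one-dimensional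
  sums.\<close>

lemma summable_on_prod_cart:
  fixes f :: "'b \<Rightarrow> real"
  assumes "\<And>x. 0 \<le> f x" "f summable_on UNIV"
  shows "(\<lambda>v :: 'b ^ 'd. \<Prod>i\<in>UNIV. f (v $ i)) summable_on UNIV"
proof (rule nonneg_bdd_above_summable_on)
  show "0 \<le> (\<Prod>i\<in>UNIV. f (v $ i))" for v :: "'b ^ 'd"
    by (intro prod_nonneg assms)
  have "(\<Sum>v\<in>F. \<Prod>i\<in>UNIV. f (v $ i)) \<le> (\<Prod>i\<in>(UNIV :: 'd set). infsum f UNIV)"
    if F: "finite F" for F :: "('b ^ 'd) set"
  proof -
    define T where "T = (\<Union>v\<in>F. range (($) v))"
    have T: "finite T"
      using F by (auto simp: T_def)
    have fin: "finite (PiE (UNIV :: 'd set) (\<lambda>_. T))"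
      using T by (intro finite_PiE) auto
    have "(\<Sum>v\<in>F. \<Prod>i\<in>UNIV. f (v $ i)) = (\<Sum>g\<in>($) ` F. \<Prod>i\<in>UNIV. f (g i))"
      by (subst sum.reindex) (auto simp: inj_on_def vec_eq_iff fun_eq_iff)
    also have "\<dots> \<le> (\<Sum>g\<in>PiE (UNIV :: 'd set) (\<lambda>_. T). \<Prod>i\<in>UNIV. f (g i))"
      by (rule sum_mono2[OF fin]) (auto simp: T_def intro!: prod_nonneg assms)
    also have "\<dots> = (\<Prod>i\<in>(UNIV :: 'd set). \<Sum>x\<in>T. f x)"
      using T by (subst prod_sum_PiE) auto
    also have "\<dots> \<le> (\<Prod>i\<in>(UNIV :: 'd set). infsum f UNIV)"
      using T by (intro prod_mono conjI finite_sum_le_infsum assms) (auto intro!: sum_nonneg assms)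
    finally show ?thesis .
  qed
  then show "bdd_above (sum (\<lambda>v :: 'b ^ 'd. \<Prod>i\<in>UNIV. f (v $ i)) ` {F. F \<subseteq> UNIV \<and> finite F})"
    by (auto intro!: bdd_aboveI)
qed

lemma summable_on_exp_is_norm:
  fixes N :: "real ^ 'd \<Rightarrow> real" and a :: real
  assumes "is_norm N" "a > 0"
  shows "(\<lambda>k :: int ^ 'd. exp (- a * N (lattice_vec k))) summable_on UNIV"
proof -
  obtain c where c: "c > 0" "\<And>x. c * norm x \<le> N x"
    using is_norm_lower_bound[OF assms(1)] by blast
  \<comment> \<open>Each coordinate is at most the Euclidean norm, so the sum of their moduli is at
    most \<open>CARD('d)\<close> times it; dividing by \<open>CARD('d)\<close> compensates.\<close>
  define b where "b = a * c / real CARD('d)"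
  have b: "b > 0"
    using assms c by (simp add: b_def)
  have "exp (- a * N (lattice_vec k)) \<le> (\<Prod>i\<in>UNIV. exp (- b * \<bar>real_of_int (k $ i)\<bar>))"
    for k :: "int ^ 'd"
  proof -
    have "(\<Sum>i\<in>UNIV. \<bar>real_of_int (k $ i)\<bar>) \<le> (\<Sum>i\<in>(UNIV :: 'd set). norm (lattice_vec k))"
      using component_le_norm_cart[of "lattice_vec k"]
      by (intro sum_mono) (simp add: lattice_vec_def)
    then have "b * (\<Sum>i\<in>UNIV. \<bar>real_of_int (k $ i)\<bar>) \<le> b * (real CARD('d) * norm (lattice_vec k))"
      using b by (intro mult_left_mono) auto
    also have "\<dots> = a * (c * norm (lattice_vec k))"
      by (simp add: b_def)
    also have "\<dots> \<le> a * N (lattice_vec k)"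
      using assms c by (intro mult_left_mono) auto
    finally show ?thesis
      by (simp add: exp_sum[symmetric] sum_negf sum_distrib_left)
  qed
  then show ?thesis
    by (intro summable_on_comparison_test[OF summable_on_prod_cart[OF _ summable_on_exp_abs_int[OF b]]])
      auto
qed

text \<open>The group estimate is applied to \<open>N\<close> composed with
  \<open>lattice_vec\<close>; additivity of the embedding transfers the norm axioms to the
  lattice.\<close>

theorem theorem1:
  fixes A :: "(int ^ 'd) ell2 \<Rightarrow>\<^sub>L (int ^ 'd) ell2"
    and N :: "real ^ 'd \<Rightarrow> real"
    and C \<gamma> :: real
  assumes "is_norm N"
    and "A \<in> bounded_ops"
    and "C > 0" and "\<gamma> > 0"
    and "\<And>k l. cmod (matrix_entry A k l) \<le> C * exp (- \<gamma> * N (lattice_vec (k - l)))"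
    and "invertible_op A"
  shows "\<exists>C' > 0. \<exists>\<gamma>' > 0. \<forall>k l.
           cmod (matrix_entry (inverse_op A) k l) \<le> C' * exp (- \<gamma>' * N (lattice_vec (k - l)))"
proof (rule exponential_decay_inverse[where p = "\<lambda>k. N (lattice_vec k)" and C = C and \<gamma> = \<gamma>])
  have N: "\<And>x. 0 \<le> N x" "\<And>x. N x = 0 \<longleftrightarrow> x = 0" "\<And>a x. N (a *\<^sub>R x) = \<bar>a\<bar> * N x"
    "\<And>x y. N (x + y) \<le> N x + N y"
    using assms(1) by (auto simp: is_norm_def)
  show "0 \<le> N (lattice_vec k)" for k
    by (rule N)
  show "N (lattice_vec 0) = 0"
    by (simp add: N(2) lattice_vec_def vec_eq_iff)
  have "lattice_vec (- k) = (- 1) *\<^sub>R lattice_vec k" for k :: "int ^ 'd"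
    by (simp add: lattice_vec_def vec_eq_iff)
  then show "N (lattice_vec (- k)) = N (lattice_vec k)" for k
    using N(3)[of "- 1" "lattice_vec k"] by simp
  have "lattice_vec (k + l) = lattice_vec k + lattice_vec l" for k l :: "int ^ 'd"
    by (simp add: lattice_vec_def vec_eq_iff)
  then show "N (lattice_vec (k + l)) \<le> N (lattice_vec k) + N (lattice_vec l)" for k l
    by (simp add: N(4))
  show "(\<lambda>k. exp (- a * N (lattice_vec k))) summable_on UNIV" if "0 < a" for a
    by (rule summable_on_exp_is_norm[OF assms(1) that])
  show "A o\<^sub>L inverse_op A = id_blinfun" "inverse_op A o\<^sub>L A = id_blinfun"
    using is_inverse_op_inverse_op[OF assms(6)] by (simp_all add: is_inverse_op_def)
qed (use assms in auto)

end
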